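(* Let $a\in\mathbb{R}$, $\alpha>0$, $\beta>0$, $\gamma\in[0,1]$, let $k\in\mathbb{R}$ be a constant, and let $f(t)=k$ for all $t\in\mathbb{N}_a=\{a,a+1,a+2,\ldots\}$. Then for all $t\in\mathbb{N}_a$, $$\left({}_{\gamma}\diamondsuit_a^{-\alpha,-\beta}f\right)(t)=\gamma\,\frac{\Gamma(t-a+1+\alpha)\,k}{\Gamma(\alpha+1)\Gamma(t-a+1)}+(1-\gamma)\,\frac{\Gamma(t-a+1+\beta)\,k}{\Gamma(\beta+1)\Gamma(t-a+1)}.$$
   Context: For real $\alpha$, $t^{(\alpha)}=\frac{\Gamma(t+1)}{\Gamma(t+1-\alpha)}$ and $t^{\overline{\alpha}}=\frac{\Gamma(t+\alpha)}{\Gamma(t)}$, where $\Gamma$ is the Euler gamma function; $\sigma(s)=s+1$, $\rho(s)=s-1$. For $a\in\mathbb{R}$ and $\mathbb{N}_a=\{a,a+1,a+2,\ldots\}$, a sum $\sum_{s=a}^{b}$ with $b\in\mathbb{N}_a$ runs over $s=a,a+1,\ldots,b$. Delta fractional sum ($\alpha>0$): for $f$ on $\mathbb{N}_a$ and $t\in\mathbb{N}_{a+\alpha}$, $(\Delta_a^{-\alpha}f)(t)=\frac{1}{\Gamma(\alpha)}\sum_{s=a}^{t-\alpha}(t-\sigma(s))^{(\alpha-1)}f(s)$. Nabla fractional sum ($\beta>0$): for $f$ on $\mathbb{N}_a$ and $t\in\mathbb{N}_a$, $(\nabla_a^{-\beta}f)(t)=\frac{1}{\Gamma(\beta)}\sum_{s=a}^{t}(t-\rho(s))^{\overline{\beta-1}}f(s)$.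 Diamond-$\gamma$ fractional sum of order $(\alpha,\beta)$ ($\alpha,\beta>0$, $\gamma\in[0,1]$): for $t\in\mathbb{N}_a$, $\left({}_{\gamma}\diamondsuit_a^{-\alpha,-\beta}f\right)(t)=\gamma(\Delta_a^{-\alpha}f)(t+\alpha)+(1-\gamma)(\nabla_a^{-\beta}f)(t)$. *)

theory Defs
  imports "HOL-Analysis.Gamma_Function"
begin

definition nat_from :: "real \<Rightarrow> real set" where
  "nat_from a = {a + real n | n. True}"

text \<open>
  The generalized falling and rising powers. In the library \<open>Gamma\<close> is \<open>0\<close> at its poles and
  division by \<open>0\<close> yields \<open>0\<close>, so a quotient whose denominator sits at a pole is \<open>0\<close>, which is
  the usual convention. A pole in the numerator also yields \<open>0\<close>; there the power is undefined.
\<close>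

definition falling_power :: "real \<Rightarrow> real \<Rightarrow> real" where
  "falling_power t \<alpha> = Gamma (t + 1) / Gamma (t + 1 - \<alpha>)"

definition rising_power :: "real \<Rightarrow> real \<Rightarrow> real" where
  "rising_power t \<alpha> = Gamma (t + \<alpha>) / Gamma t"

definition forward_jump :: "real \<Rightarrow> real" where
  "forward_jump s = s + 1"

definition backward_jump :: "real \<Rightarrow> real" where
  "backward_jump s = s - 1"

text \<open>
  Functions on \<open>nat_from a\<close> are represented by total functions on the reals; only their values on
  \<open>nat_from a\<close> enter the sum below, which is \<open>f a + f (a + 1) + \<dots> + f b\<close> for \<open>b \<in> nat_from a\<close>.
\<close>

definition unit_step_sum :: "real \<Rightarrow> real \<Rightarrow> (real \<Rightarrow> real) \<Rightarrow> real" where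
  "unit_step_sum a b f = (\<Sum>s\<in>{s \<in> nat_from a. s \<le> b}. f s)"

text \<open>
  The delta sum is meant for \<open>t \<in> nat_from (a + \<alpha>)\<close>, the nabla and diamond sums for
  \<open>t \<in> nat_from a\<close>; elsewhere their values carry no meaning. The orders are positive: the
  parameters \<open>\<alpha>\<close> and \<open>\<beta>\<close> stand for the operators with exponents \<open>-\<alpha>\<close> and \<open>-\<beta>\<close>.
\<close>

definition delta_frac_sum :: "real \<Rightarrow> real \<Rightarrow> (real \<Rightarrow> real) \<Rightarrow> real \<Rightarrow> real" where
  "delta_frac_sum a \<alpha> f t =
     1 / Gamma \<alpha> *
     unit_step_sum a (t - \<alpha>) (\<lambda>s. falling_power (t - forward_jump s) (\<alpha> - 1) * f s)"

definition nabla_frac_sum :: "real \<Rightarrow> real \<Rightarrow> (real \<Rightarrow> real) \<Rightarrow> real \<Rightarrow> real" where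
  "nabla_frac_sum a \<beta> f t =
     1 / Gamma \<beta> *
     unit_step_sum a t (\<lambda>s. rising_power (t - backward_jump s) (\<beta> - 1) * f s)"

definition diamond_frac_sum ::
  "real \<Rightarrow> real \<Rightarrow> real \<Rightarrow> real \<Rightarrow> (real \<Rightarrow> real) \<Rightarrow> real \<Rightarrow> real" where
  "diamond_frac_sum \<gamma> a \<alpha> \<beta> f t =
     \<gamma> * delta_frac_sum a \<alpha> f (t + \<alpha>) + (1 - \<gamma>) * nabla_frac_sum a \<beta> f t"

end

theory Submission
  imports Defs
begin

text \<open>
  Evaluated at \<open>t + \<alpha>\<close>, the delta kernel is \<open>\<Gamma>(t - s + \<alpha>) / \<Gamma>(t - s + 1)\<close>. The nabla kernel at
  \<open>t\<close> is the same expression with \<open>\<beta>\<close> for \<open>\<alpha>\<close>, so on \<open>nat_from a\<close> the shifted delta sum and the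
  nabla sum of equal order coincide for every \<open>f\<close>. For constant \<open>f\<close> one computation therefore
  settles both summands: the kernel depends only on \<open>t - s\<close>, which runs through \<open>0, \<dots>, n\<close> when
  \<open>t = a + n\<close>, and the sum of the kernel telescopes by the functional equation of \<open>\<Gamma>\<close>
  (\<open>sum_Gamma_ratio\<close>).
\<close>

text \<open>
  This is the hockey-stick identity for binomial coefficients with a real parameter: dividing by
  \<open>\<Gamma>(\<alpha>)\<close> turns the summand into the coefficient \<open>m + \<alpha> - 1\<close> over \<open>m\<close> and the right-hand side
  into \<open>n + \<alpha>\<close> over \<open>n\<close>.
\<close>

lemma sum_Gamma_ratio:
  fixes \<alpha> :: real
  assumes "\<alpha> > 0"
  shows "(\<Sum>m\<le>n. Gamma (real m + \<alpha>) / Gamma (real m + 1)) =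
         Gamma (real n + 1 + \<alpha>) / (\<alpha> * Gamma (real n + 1))"
proof (induction n)
  case 0
  show ?case using assms Gamma_plus1[of \<alpha>] by (auto simp: add.commute nonpos_Ints_def)
next
  case (Suc n)
  define g where "g = Gamma (real n + 1 + \<alpha>)"
  define h where "h = Gamma (real n + 1)"
  have numerator: "Gamma (real (Suc n) + 1 + \<alpha>) = (real n + 1 + \<alpha>) * g"
    using Gamma_plus1[of "real n + 1 + \<alpha>"] assms
    by (auto simp: g_def add_ac nonpos_Ints_def)
  have denominator: "Gamma (real (Suc n) + 1) = (real n + 1) * h"
    using Gamma_plus1[of "real n + 1"]
    by (auto simp: h_def add_ac nonpos_Ints_def)
  have "h > 0" unfolding h_def by (rule Gamma_real_pos) simp
  have "(\<Sum>m\<le>Suc n. Gamma (real m + \<alpha>) / Gamma (real m + 1)) =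
        g / (\<alpha> * h) + g / ((real n + 1) * h)"
    using Suc.IH denominator by (simp add: g_def h_def add_ac)
  also have "\<dots> = (real n + 1 + \<alpha>) * g / (\<alpha> * ((real n + 1) * h))"
    using assms \<open>h > 0\<close> by (simp add: divide_simps) (simp add: algebra_simps)
  finally show ?case by (simp only: numerator denominator)
qed

lemma unit_step_sum_reversed:
  "unit_step_sum a (a + real n) f = (\<Sum>m\<le>n. f (a + real n - real m))"
proof -
  have "{s \<in> nat_from a. s \<le> a + real n} = (\<lambda>i. a + real i) ` {..n}"
    by (auto simp: nat_from_def)
  then have "unit_step_sum a (a + real n) f = (\<Sum>i\<le>n. f (a + real i))"
    unfolding unit_step_sum_def by (simp add: sum.reindex inj_on_def)
  also have "\<dots> = (\<Sum>m\<le>n. f (a + real (n - m)))"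
    by (rule sum.nat_diff_reindex[symmetric, of _ "Suc n", simplified lessThan_Suc_atMost, simplified])
  also have "\<dots> = (\<Sum>m\<le>n. f (a + real n - real m))"
    by (rule sum.cong) (auto simp: of_nat_diff add_diff_eq)
  finally show ?thesis .
qed

lemma nabla_frac_sum_const:
  fixes \<beta> :: real
  assumes "\<beta> > 0" and const: "\<forall>t\<in>nat_from a. f t = k" and "t \<in> nat_from a"
  shows "nabla_frac_sum a \<beta> f t =
         Gamma (t - a + 1 + \<beta>) * k / (Gamma (\<beta> + 1) * Gamma (t - a + 1))"
proof -
  obtain n where t: "t = a + real n"
    using \<open>t \<in> nat_from a\<close> by (auto simp: nat_from_def)
  have f_eq: "f (a + real n - real m) = k" if "m \<le> n" for m
  proof -
    have "a + real n - real m = a + real (n - m)"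
      using that by (simp add: of_nat_diff)
    then show ?thesis using const unfolding nat_from_def by blast
  qed
  have "unit_step_sum a t (\<lambda>s. rising_power (t - backward_jump s) (\<beta> - 1) * f s) =
        (\<Sum>m\<le>n. Gamma (real m + \<beta>) / Gamma (real m + 1) * k)"
    unfolding t unit_step_sum_reversed
    by (rule sum.cong) (simp_all add: f_eq rising_power_def backward_jump_def)
  also have "\<dots> = Gamma (real n + 1 + \<beta>) / (\<beta> * Gamma (real n + 1)) * k"
    using sum_Gamma_ratio[OF \<open>\<beta> > 0\<close>, of n] by (simp only: sum_distrib_right[symmetric])
  finally have "nabla_frac_sum a \<beta> f t =
      1 / Gamma \<beta> * (Gamma (real n + 1 + \<beta>) / (\<beta> * Gamma (real n + 1)) * k)"
    by (simp only: nabla_frac_sum_def)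
  moreover have "Gamma (\<beta> + 1) = \<beta> * Gamma \<beta>"
    using Gamma_plus1[of \<beta>] \<open>\<beta> > 0\<close> by (auto simp: nonpos_Ints_def)
  ultimately show ?thesis by (simp add: t mult_ac)
qed

text \<open>
  The delta kernel at \<open>t + \<alpha>\<close> agrees with the nabla kernel at \<open>t\<close> because
  \<open>(t + \<alpha> - \<sigma>(s)) + 1 = (t - \<rho>(s)) + (\<alpha> - 1)\<close>; this shift by \<open>\<alpha>\<close> also brings the upper summation
  limit of the delta sum back to \<open>t\<close>.
\<close>

lemma delta_frac_sum_shift_eq_nabla_frac_sum:
  "delta_frac_sum a \<alpha> f (t + \<alpha>) = nabla_frac_sum a \<alpha> f t"
proof -
  have "falling_power (t + \<alpha> - forward_jump s) (\<alpha> - 1) =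
        rising_power (t - backward_jump s) (\<alpha> - 1)" for s
    by (simp add: falling_power_def rising_power_def forward_jump_def backward_jump_def
        algebra_simps)
  then show ?thesis by (simp add: delta_frac_sum_def nabla_frac_sum_def)
qed

theorem theorem3p5:
  fixes a \<alpha> \<beta> \<gamma> k :: real and f :: "real \<Rightarrow> real"
  assumes "\<alpha> > 0" and "\<beta> > 0" and "\<gamma> \<in> {0..1}"
    and "\<forall>t\<in>nat_from a. f t = k"
  shows "\<forall>t\<in>nat_from a.
    diamond_frac_sum \<gamma> a \<alpha> \<beta> f t =
      \<gamma> * (Gamma (t - a + 1 + \<alpha>) * k / (Gamma (\<alpha> + 1) * Gamma (t - a + 1))) +
      (1 - \<gamma>) * (Gamma (t - a + 1 + \<beta>) * k / (Gamma (\<beta> + 1) * Gamma (t - a + 1)))"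
  unfolding diamond_frac_sum_def delta_frac_sum_shift_eq_nabla_frac_sum
  by (intro ballI) (simp only: nabla_frac_sum_const[OF assms(1,4)] nabla_frac_sum_const[OF assms(2,4)])

end
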